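(* Let $R$ and $R'$ be rings and $f:R\rightarrow R'$ a surjective ring homomorphism. If every quasi sdf-absorbing ideal of $R$ is an sdf-absorbing primary ideal of $R$, then every quasi sdf-absorbing ideal of $R'$ is an sdf-absorbing primary ideal of $R'$.
   Context: All rings are commutative with identity. An ideal $I$ of a ring $R$ is called sdf-absorbing if for all non-zero $a,b\in R$, $a^{2}-b^{2}\in I$ implies $a-b\in I$ or $a+b\in I$. A proper ideal $I$ of $R$ is called quasi sdf-absorbing if its radical $\sqrt{I}$ is an sdf-absorbing ideal of $R$. An ideal $I$ of $R$ is called sdf-absorbing primary if for all $a,b\in R$, $a^{2}-b^{2}\in I$ implies $a+b\in\sqrt{I}$ or $a-b\in I$. *)

theory Defs
  imports "HOL-Algebra.Algebra"
begin

definition radical :: "('a, 'm) ring_scheme \<Rightarrow> 'a set \<Rightarrow> 'a set" where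
  "radical R I = {x \<in> carrier R. \<exists>n::nat. n \<ge> 1 \<and> x [^]\<^bsub>R\<^esub> n \<in> I}"

definition sdf_absorbing :: "('a, 'm) ring_scheme \<Rightarrow> 'a set \<Rightarrow> bool" where
  "sdf_absorbing R I \<longleftrightarrow> ideal I R \<and>
     (\<forall>a \<in> carrier R - {\<zero>\<^bsub>R\<^esub>}. \<forall>b \<in> carrier R - {\<zero>\<^bsub>R\<^esub>}.
        a [^]\<^bsub>R\<^esub> (2::nat) \<ominus>\<^bsub>R\<^esub> b [^]\<^bsub>R\<^esub> (2::nat) \<in> I
          \<longrightarrow> a \<ominus>\<^bsub>R\<^esub> b \<in> I \<or> a \<oplus>\<^bsub>R\<^esub> b \<in> I)"

definition quasi_sdf_absorbing :: "('a, 'm) ring_scheme \<Rightarrow> 'a set \<Rightarrow> bool" where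
  "quasi_sdf_absorbing R I \<longleftrightarrow>
     ideal I R \<and> I \<noteq> carrier R \<and> sdf_absorbing R (radical R I)"

definition sdf_absorbing_primary :: "('a, 'm) ring_scheme \<Rightarrow> 'a set \<Rightarrow> bool" where
  "sdf_absorbing_primary R I \<longleftrightarrow> ideal I R \<and>
     (\<forall>a \<in> carrier R. \<forall>b \<in> carrier R.
        a [^]\<^bsub>R\<^esub> (2::nat) \<ominus>\<^bsub>R\<^esub> b [^]\<^bsub>R\<^esub> (2::nat) \<in> I
          \<longrightarrow> a \<oplus>\<^bsub>R\<^esub> b \<in> radical R I \<or> a \<ominus>\<^bsub>R\<^esub> b \<in> I)"

end

theory Submission
  imports Defs
begin

text \<open>Pull an ideal \<open>J\<close> of the codomain back to \<open>I\<close>: radicals and all the membership conditions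
  commute with preimages along the surjection. The one point to check is that the condition of being
  sdf-absorbing excludes zero, while a non-zero element of \<open>R\<close> may map to zero; radical ideals
  satisfy the condition for zero arguments anyway.\<close>

lemma (in ring_hom_cring) radical_preimage:
  "radical R {x \<in> carrier R. h x \<in> J} = {x \<in> carrier R. h x \<in> radical S J}"
  by (auto simp: radical_def)

lemma (in cring) radical_of_square:
  assumes "x \<in> carrier R" "x [^] (2::nat) \<in> radical R I"
  shows "x \<in> radical R I"
proof -
  obtain n :: nat where "n \<ge> 1" "(x [^] (2::nat)) [^] n \<in> I"
    using assms(2) by (auto simp: radical_def)
  then show ?thesis
    using assms(1) by (auto simp: radical_def nat_pow_pow intro!: exI[of _ "2 * n"])
qed

text \<open>When one argument is zero, the hypothesis puts the square of the other, up to sign, into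
  the radical, and a radical contains every element whose square it contains.\<close>

lemma (in cring) sdf_absorbing_radicalD:
  assumes sdf: "sdf_absorbing R (radical R I)"
    and a: "a \<in> carrier R" and b: "b \<in> carrier R"
    and ab: "a [^] (2::nat) \<ominus> b [^] (2::nat) \<in> radical R I"
  shows "a \<ominus> b \<in> radical R I \<or> a \<oplus> b \<in> radical R I"
proof -
  interpret I: ideal "radical R I" R
    using sdf by (simp add: sdf_absorbing_def)
  consider "a = \<zero>" | "b = \<zero>" | "a \<noteq> \<zero>" "b \<noteq> \<zero>" by blast
  then show ?thesis
  proof cases
    case 1
    then have "\<ominus> (b [^] (2::nat)) \<in> radical R I"
      using ab b by (simp add: minus_eq nat_pow_zero)
    then have "\<ominus> (\<ominus> (b [^] (2::nat))) \<in> radical R I"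
      by (rule I.a_inv_closed)
    then have "b [^] (2::nat) \<in> radical R I"
      using b by simp
    then have "b \<in> radical R I" by (rule radical_of_square[OF b])
    then show ?thesis using 1 b by simp
  next
    case 2
    then have "a [^] (2::nat) \<in> radical R I"
      using ab a by (simp add: minus_eq nat_pow_zero)
    then have "a \<in> radical R I" by (rule radical_of_square[OF a])
    then show ?thesis using 2 a by simp
  next
    case 3
    then show ?thesis using sdf a b ab by (simp add: sdf_absorbing_def)
  qed
qed

lemma (in ring_hom_cring) quasi_sdf_absorbing_preimage:
  assumes surj: "h ` carrier R = carrier S" and J: "quasi_sdf_absorbing S J"
  shows "quasi_sdf_absorbing R {x \<in> carrier R. h x \<in> J}" (is "quasi_sdf_absorbing R ?I")
proof -
  interpret J: ideal J S using J by (simp add: quasi_sdf_absorbing_def)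
  have sdf: "sdf_absorbing S (radical S J)"
    using J by (simp add: quasi_sdf_absorbing_def)
  have "?I \<noteq> carrier R"
  proof
    \<comment> \<open>Properness rests on surjectivity: \<open>J\<close> would contain the image of
      \<open>h\<close>, which is all of \<open>S\<close>.\<close>
    assume "?I = carrier R"
    then have "h ` carrier R \<subseteq> J" by blast
    then show False using surj J J.a_subset by (auto simp: quasi_sdf_absorbing_def)
  qed
  moreover have "ideal (radical R ?I) R"
    using sdf by (simp add: radical_preimage ring.ideal_vimage sdf_absorbing_def)
  \<comment> \<open>The condition is tested in \<open>S\<close> at \<open>h a\<close> and
    \<open>h b\<close>, either of which may be zero, hence the version for arbitrary
    arguments.\<close>
  then have "sdf_absorbing R (radical R ?I)"
    using S.sdf_absorbing_radicalD[OF sdf] by (simp add: sdf_absorbing_def radical_preimage)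
  ultimately show ?thesis
    using ring.ideal_vimage[OF J.ideal_axioms] by (simp add: quasi_sdf_absorbing_def)
qed

text \<open>Any two elements of \<open>S\<close> lift to \<open>R\<close>, and \<open>h\<close>
  carries the alternative obtained for the lifts back to \<open>S\<close>. The primary condition
  ranges over all elements, so any lifts will do.\<close>

lemma (in ring_hom_cring) sdf_absorbing_primary_of_preimage:
  assumes surj: "h ` carrier R = carrier S" and J: "ideal J S"
    and I: "sdf_absorbing_primary R {x \<in> carrier R. h x \<in> J}"
  shows "sdf_absorbing_primary S J"
  unfolding sdf_absorbing_primary_def
proof (intro conjI ballI impI J)
  fix x y
  assume "x \<in> carrier S" "y \<in> carrier S"
    and xy: "x [^]\<^bsub>S\<^esub> (2::nat) \<ominus>\<^bsub>S\<^esub> y [^]\<^bsub>S\<^esub> (2::nat) \<in> J"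
  then obtain a b where "a \<in> carrier R" "x = h a" "b \<in> carrier R" "y = h b"
    using surj by (metis imageE)
  then show "x \<oplus>\<^bsub>S\<^esub> y \<in> radical S J \<or> x \<ominus>\<^bsub>S\<^esub> y \<in> J"
    using I xy by (simp add: sdf_absorbing_primary_def radical_preimage)
qed

theorem proposition4p3:
  fixes R :: "('a, 'm) ring_scheme" and R' :: "('b, 'n) ring_scheme" and f :: "'a \<Rightarrow> 'b"
  assumes "cring R" and "cring R'"
    and "f \<in> ring_hom R R'" and "f ` carrier R = carrier R'"
    and "\<forall>I. quasi_sdf_absorbing R I \<longrightarrow> sdf_absorbing_primary R I"
  shows "\<forall>J. quasi_sdf_absorbing R' J \<longrightarrow> sdf_absorbing_primary R' J"
proof -
  interpret ring_hom_cring R R' f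
    using assms(1-3) by (simp add: ring_hom_cring_def ring_hom_cring_axioms_def)
  \<comment> \<open>The assumption on \<open>R\<close> is applied to the preimage of
    \<open>J\<close>; unfolding \<open>quasi_sdf_absorbing\<close> supplies that \<open>J\<close> is
    an ideal.\<close>
  show ?thesis
    using assms(4,5) quasi_sdf_absorbing_preimage sdf_absorbing_primary_of_preimage
    by (meson quasi_sdf_absorbing_def)
qed

end
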